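(* Let $\Omega\subset\mathbb C^n$ be a bounded domain and $p>0$. For every $z\in\Omega$ and every $X=\sum_jX_j\,\partial/\partial z_j$ with $(X_1,\dots,X_n)\in\mathbb C^n$, one has $B_p(z;X)\ge C(z;X)$.
   Context: For $p>0$, $A^p(\Omega)$ is the space of holomorphic functions $f$ on $\Omega$ with $\|f\|_p^p:=\int_\Omega|f|^p<\infty$ (Lebesgue measure); $A^\infty(\Omega)$ is the space of bounded holomorphic functions with the sup norm $\|\cdot\|_\infty$. Put $m_p(z):=\inf\{\|f\|_p: f\in A^p(\Omega),\ f(z)=1\}$ and $K_p(z):=m_p(z)^{-p}$. Write $Xf=\sum_jX_j\,\partial f/\partial z_j$. The $p$-Bergman metric is $B_p(z;X):=K_p(z)^{-1/p}\cdot\sup\{|Xf(z)|: f\in A^p(\Omega),\ f(z)=0,\ \|f\|_p=1\}$, and the Carathéodory metric is $C(z;X):=\sup\{|Xf(z)|: f\in A^\infty(\Omega),\ f(z)=0,\ \|f\|_\infty=1\}$. *)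

theory Defs
  imports "HOL-Complex_Analysis.Complex_Analysis"
begin

text \<open>
  Functions on a set \<open>\<Omega>\<close> of complex \<open>n\<close>-vectors are total functions whose values outside \<open>\<Omega>\<close>
  are arbitrary; every notion below depends only on the values on \<open>\<Omega>\<close> when \<open>\<Omega>\<close> is open.
\<close>

text \<open>The library notion of holomorphy covers one variable only. Here: at every point there is a
  Frechet derivative and it is complex-linear.\<close>

definition mv_holomorphic_on :: "(complex ^ 'n \<Rightarrow> complex) \<Rightarrow> (complex ^ 'n) set \<Rightarrow> bool"
  where "mv_holomorphic_on f \<Omega> \<longleftrightarrow>
    (\<forall>z\<in>\<Omega>. \<exists>D. (f has_derivative D) (at z) \<and> (\<forall>c v. D (c *s v) = c * D v))"

definition partial_z :: "'n \<Rightarrow> (complex ^ 'n \<Rightarrow> complex) \<Rightarrow> complex ^ 'n \<Rightarrow> complex"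
  where "partial_z j f z = deriv (\<lambda>h. f (z + axis j h)) 0"

definition vf_apply :: "complex ^ 'n \<Rightarrow> (complex ^ 'n \<Rightarrow> complex) \<Rightarrow> complex ^ 'n \<Rightarrow> complex"
  where "vf_apply X f z = (\<Sum>j\<in>UNIV. X $ j * partial_z j f z)"

definition Lp_norm :: "real \<Rightarrow> (complex ^ 'n) set \<Rightarrow> (complex ^ 'n \<Rightarrow> complex) \<Rightarrow> real"
  where "Lp_norm p \<Omega> f = (LINT z:\<Omega>|lebesgue. norm (f z) powr p) powr (1 / p)"

definition bergman_space :: "real \<Rightarrow> (complex ^ 'n) set \<Rightarrow> (complex ^ 'n \<Rightarrow> complex) set"
  where "bergman_space p \<Omega> =
    {f. mv_holomorphic_on f \<Omega> \<and> set_integrable lebesgue \<Omega> (\<lambda>z. norm (f z) powr p)}"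

definition sup_norm :: "(complex ^ 'n) set \<Rightarrow> (complex ^ 'n \<Rightarrow> complex) \<Rightarrow> real"
  where "sup_norm \<Omega> f = (SUP z\<in>\<Omega>. norm (f z))"

definition bounded_holomorphic :: "(complex ^ 'n) set \<Rightarrow> (complex ^ 'n \<Rightarrow> complex) set"
  where "bounded_holomorphic \<Omega> = {f. mv_holomorphic_on f \<Omega> \<and> bounded (f ` \<Omega>)}"

text \<open>
  The infimum and suprema below are taken in the reals. For a bounded domain \<open>\<Omega>\<close>, \<open>z \<in> \<Omega>\<close> and
  \<open>p > 0\<close> no default values arise: the sets are nonempty (constants, respectively normalised
  affine functions), the suprema are finite by the mean value inequality for \<open>|f| powr p\<close> and the
  Cauchy estimates, and the infimum is positive by the same mean value inequality.
\<close>

definition bergman_min :: "real \<Rightarrow> (complex ^ 'n) set \<Rightarrow> complex ^ 'n \<Rightarrow> real"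
  where "bergman_min p \<Omega> z = Inf {Lp_norm p \<Omega> f |f. f \<in> bergman_space p \<Omega> \<and> f z = 1}"

definition bergman_kernel :: "real \<Rightarrow> (complex ^ 'n) set \<Rightarrow> complex ^ 'n \<Rightarrow> real"
  where "bergman_kernel p \<Omega> z = bergman_min p \<Omega> z powr (- p)"

definition bergman_metric ::
    "real \<Rightarrow> (complex ^ 'n) set \<Rightarrow> complex ^ 'n \<Rightarrow> complex ^ 'n \<Rightarrow> real"
  where "bergman_metric p \<Omega> z X =
    bergman_kernel p \<Omega> z powr (- 1 / p) *
    Sup {norm (vf_apply X f z) |f. f \<in> bergman_space p \<Omega> \<and> f z = 0 \<and> Lp_norm p \<Omega> f = 1}"

definition caratheodory_metric :: "(complex ^ 'n) set \<Rightarrow> complex ^ 'n \<Rightarrow> complex ^ 'n \<Rightarrow> real"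
  where "caratheodory_metric \<Omega> z X =
    Sup {norm (vf_apply X f z) |f. f \<in> bounded_holomorphic \<Omega> \<and> f z = 0 \<and> sup_norm \<Omega> f = 1}"

end

theory Submission
  imports Defs
begin

text \<open>
  Let \<open>f\<close> compete in the Caratheodory metric: \<open>|f| \<le> 1\<close> on \<open>\<Omega>\<close> and \<open>f z = 0\<close>. Let \<open>g\<close> compete in the
  definition of \<open>m\<^sub>p(z)\<close>: \<open>g\<close> lies in the Bergman space and \<open>g z = 1\<close>. The product \<open>f g\<close> lies in the
  Bergman space with norm at most \<open>\<parallel>g\<parallel>\<^sub>p\<close>, vanishes at \<open>z\<close>, and satisfies
  \<open>X(f g)(z) = Xf(z)\<close> by the product rule. If \<open>S\<close> is the supremum in the definition of the Bergman
  metric, then \<open>|Xf(z)| \<le> \<parallel>f g\<parallel>\<^sub>p S \<le> \<parallel>g\<parallel>\<^sub>p S\<close>. Taking the infimum over \<open>g\<close> gives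
  \<open>|Xf(z)| \<le> m\<^sub>p(z) S = B\<^sub>p(z;X)\<close>, and the claim is the supremum over \<open>f\<close>.

  The first of these inequalities needs \<open>S\<close> to be finite (\<open>bdd_above_unit_derivatives\<close>), and this
  is where the analysis lies. By Cauchy's estimate it is enough to bound the functions of
  \<open>p\<close>-norm 1 uniformly near \<open>z\<close>. For exponent 1 this is the mean value inequality over balls
  (\<open>norm_mv_holomorphic_le_ball_mean\<close>), which follows from Cauchy's formula on complex lines and the
  invariance of Lebesgue measure under unimodular scalars (\<open>nn_integral_lborel_orthogonal\<close>).
  Exponents above 1 reduce to exponent 1 because \<open>t \<le> 1 + t powr p\<close> and balls have finite volume; those
  below 1 are reached by a maximum argument (\<open>mv_holomorphic_locally_bounded_of_small_powr_integral\<close>).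
\<close>

section \<open>Orthogonal invariance of Lebesgue measure\<close>

lemma nn_integral_lborel_translate:
  fixes h :: "'a::euclidean_space \<Rightarrow> ennreal"
  assumes [measurable]: "h \<in> borel_measurable borel"
  shows "(\<integral>\<^sup>+x. h (a + x) \<partial>lborel) = (\<integral>\<^sup>+x. h x \<partial>lborel)"
proof -
  have "(\<integral>\<^sup>+x. h x \<partial>lborel) = (\<integral>\<^sup>+x. h x \<partial>distr lborel borel ((+) a))"
    by (simp add: lborel_distr_plus)
  also have "\<dots> = (\<integral>\<^sup>+x. h (a + x) \<partial>lborel)"
    by (subst nn_integral_distr) auto
  finally show ?thesis ..
qed

text \<open>
  A translation-invariant measure is determined up to a factor by its value on one ball, and an
  isometry maps a ball to a ball of the same radius, so the factor is 1. The proof is the usual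
  Tonelli argument for the uniqueness of Haar measure. It avoids determinants, so it applies to every
  Euclidean space, in particular to \<open>complex ^ 'n\<close>.
\<close>

lemma nn_integral_lborel_orthogonal:
  fixes T :: "'a::euclidean_space \<Rightarrow> 'a" and h :: "'a \<Rightarrow> ennreal"
  assumes T: "orthogonal_transformation T"
    and h [measurable]: "h \<in> borel_measurable borel"
  shows "(\<integral>\<^sup>+x. h (T x) \<partial>lborel) = (\<integral>\<^sup>+x. h x \<partial>lborel)"
proof -
  let ?B = "ball (0::'a) 1"
  define S where "S = inv T"
  have TS: "T (S y) = y" for y
    unfolding S_def by (rule surj_f_inv_f[OF orthogonal_transformation_surj[OF T]])
  have linT: "linear T"
    using T by (rule orthogonal_transformation_linear)
  have S: "orthogonal_transformation S"
    unfolding S_def using T by (rule orthogonal_transformation_inv)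
  have [measurable]: "T \<in> borel_measurable borel" "S \<in> borel_measurable borel"
    using orthogonal_transformation_linear[OF T] orthogonal_transformation_linear[OF S]
    by (auto intro!: borel_measurable_continuous_onI linear_continuous_on simp: linear_conv_bounded_linear)
  have [measurable]: "?B \<in> sets borel"
    by simp
  have vol: "emeasure lborel (ball c 1 :: 'a set) = emeasure lborel ?B" for c
    by (simp add: emeasure_ball)
  have fin: "emeasure lborel ?B \<noteq> \<infinity>" "emeasure lborel ?B \<noteq> 0"
    using unit_ball_vol_pos[of "real DIM('a)", THEN less_imp_neq] by (simp_all add: emeasure_ball)
  \<comment> \<open>Compute the double integral of \<open>h (T x + y)\<close> over all \<open>x\<close> and over \<open>y\<close> in the unit ball in both
    orders. Translating \<open>x\<close> by \<open>S y\<close> produces it from the integral of \<open>h \<circ> T\<close>; translating \<open>y\<close> by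
    \<open>T x\<close> turns it into an integral of \<open>h\<close>.\<close>
  have "(\<integral>\<^sup>+x. h (T x) \<partial>lborel) * emeasure lborel ?B
      = (\<integral>\<^sup>+y. (\<integral>\<^sup>+x. h (T x) \<partial>lborel) * indicator ?B y \<partial>lborel)"
    by (simp add: nn_integral_cmult_indicator)
  also have "\<dots> = (\<integral>\<^sup>+y. (\<integral>\<^sup>+x. h (T (S y + x)) \<partial>lborel) * indicator ?B y \<partial>lborel)"
    by (subst nn_integral_lborel_translate[of "\<lambda>x. h (T x)"]) auto
  also have "\<dots> = (\<integral>\<^sup>+y. (\<integral>\<^sup>+x. h (T x + y) * indicator ?B y \<partial>lborel) \<partial>lborel)"
    by (simp add: nn_integral_multc linear_add[OF linT] TS add.commute)
  also have "\<dots> = (\<integral>\<^sup>+x. (\<integral>\<^sup>+y. h (T x + y) * indicator ?B y \<partial>lborel) \<partial>lborel)"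
    by (rule lborel_pair.Fubini') measurable
  also have "\<dots> = (\<integral>\<^sup>+x. (\<integral>\<^sup>+y. h y * indicator ?B (y - T x) \<partial>lborel) \<partial>lborel)"
  proof (rule nn_integral_cong)
    fix x
    show "(\<integral>\<^sup>+y. h (T x + y) * indicator ?B y \<partial>lborel) = (\<integral>\<^sup>+y. h y * indicator ?B (y - T x) \<partial>lborel)"
      by (subst nn_integral_lborel_translate[of "\<lambda>y. h y * indicator ?B (y - T x)" "T x", symmetric]) auto
  qed
  also have "\<dots> = (\<integral>\<^sup>+y. (\<integral>\<^sup>+x. h y * indicator ?B (y - T x) \<partial>lborel) \<partial>lborel)"
    by (rule lborel_pair.Fubini') measurable
  also have "\<dots> = (\<integral>\<^sup>+y. h y * emeasure lborel ?B \<partial>lborel)"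
  proof (rule nn_integral_cong)
    fix y
    have "norm (T x - y) = norm (S y - x)" for x
      using orthogonal_transformation_norm[OF T, of "x - S y"]
      by (simp add: linear_diff[OF linT] TS norm_minus_commute)
    then have "indicator ?B (y - T x) = (indicator (ball (S y) 1) x :: ennreal)" for x
      unfolding indicator_def mem_ball_0 mem_ball dist_norm by simp
    then have "(\<integral>\<^sup>+x. h y * indicator ?B (y - T x) \<partial>lborel) = h y * emeasure lborel (ball (S y) 1)"
      by (simp add: nn_integral_cmult_indicator)
    then show "(\<integral>\<^sup>+x. h y * indicator ?B (y - T x) \<partial>lborel) = h y * emeasure lborel ?B"
      by (simp only: vol[of "S y"])
  qed
  also have "\<dots> = (\<integral>\<^sup>+y. h y \<partial>lborel) * emeasure lborel ?B"
    by (subst nn_integral_multc) auto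
  finally show ?thesis
    using fin by (metis ennreal_mult_divide_eq infinity_ennreal_def)
qed

lemma norm_vector_smult: "norm (c *s v) = norm c * norm v" for v :: "complex ^ 'n"
  by (simp add: norm_vec_def norm_mult L2_set_right_distrib)

lemma linear_smult: "linear (\<lambda>v::complex ^ 'n. c *s v)"
  by (rule linearI) (simp_all add: vec_eq_iff algebra_simps)

lemma orthogonal_transformation_unimodular:
  assumes "norm c = 1"
  shows "orthogonal_transformation (\<lambda>v::complex ^ 'n. c *s v)"
  using assms by (simp add: orthogonal_transformation linear_smult norm_vector_smult)

section \<open>Holomorphic functions of several variables\<close>

lemma mv_holomorphic_on_subset: "mv_holomorphic_on f S \<Longrightarrow> T \<subseteq> S \<Longrightarrow> mv_holomorphic_on f T"
  unfolding mv_holomorphic_on_def by blast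

lemma mv_holomorphic_on_imp_continuous_on: "mv_holomorphic_on f S \<Longrightarrow> continuous_on S f"
  unfolding mv_holomorphic_on_def
  by (meson continuous_at_imp_continuous_on has_derivative_continuous)

lemma mv_holomorphic_on_const: "mv_holomorphic_on (\<lambda>_. c) S"
  unfolding mv_holomorphic_on_def by (auto intro!: exI[of _ "\<lambda>_. 0"])

lemma mv_holomorphic_on_component: "mv_holomorphic_on (\<lambda>x::complex ^ 'n. x $ j - c) S"
  unfolding mv_holomorphic_on_def
proof
  fix x :: "complex ^ 'n"
  have "((\<lambda>x. x $ j - c) has_derivative (\<lambda>v::complex ^ 'n. v $ j)) (at x)"
    by (auto intro!: derivative_eq_intros bounded_linear_imp_has_derivative bounded_linear_vec_nth)
  then show "\<exists>D. ((\<lambda>x::complex ^ 'n. x $ j - c) has_derivative D) (at x) \<and> (\<forall>c v. D (c *s v) = c * D v)"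
    by (intro exI[of _ "\<lambda>v. v $ j"]) simp
qed

lemma mv_holomorphic_on_mult:
  assumes "mv_holomorphic_on f S" and "mv_holomorphic_on g S"
  shows "mv_holomorphic_on (\<lambda>x. f x * g x) S"
  unfolding mv_holomorphic_on_def
proof
  fix x assume "x \<in> S"
  then obtain D E where "(f has_derivative D) (at x)" "\<And>c v. D (c *s v) = c * D v"
    and "(g has_derivative E) (at x)" "\<And>c v. E (c *s v) = c * E v"
    using assms unfolding mv_holomorphic_on_def by meson
  then show "\<exists>D. ((\<lambda>x. f x * g x) has_derivative D) (at x) \<and> (\<forall>c v. D (c *s v) = c * D v)"
    by (intro exI[of _ "\<lambda>v. f x * E v + D v * g x"] conjI has_derivative_mult)
      (auto simp: algebra_simps)
qed

text \<open>
  Restriction to complex lines is how results on one complex variable are brought to bear.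
\<close>

lemma has_field_derivative_along_line:
  fixes f :: "complex ^ 'n \<Rightarrow> complex"
  assumes f: "(f has_derivative D) (at (w + t *s x))" and D: "\<And>c v. D (c *s v) = c * D v"
  shows "((\<lambda>t. f (w + t *s x)) has_field_derivative D x) (at t)"
proof -
  have bl: "bounded_linear (\<lambda>t::complex. t *s x)"
    by (intro linear_conv_bounded_linear[THEN iffD1] linearI) (simp_all add: vec_eq_iff algebra_simps)
  have "((\<lambda>t. w + t *s x) has_derivative (\<lambda>t. t *s x)) (at t)"
    by (auto intro!: derivative_eq_intros bounded_linear_imp_has_derivative bl)
  moreover have "(\<lambda>t. t * D x) = (*) (D x)"
    by (simp add: fun_eq_iff)
  ultimately show ?thesis
    using has_derivative_compose[of "\<lambda>t. w + t *s x" "\<lambda>t. t *s x" t UNIV f D] f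
    by (simp add: D has_field_derivative_def)
qed

lemma mv_holomorphic_on_line:
  assumes "mv_holomorphic_on f S" and "\<And>t. t \<in> A \<Longrightarrow> w + t *s x \<in> S"
  shows "(\<lambda>t. f (w + t *s x)) holomorphic_on A"
  unfolding holomorphic_on_def field_differentiable_def
proof
  fix t assume "t \<in> A"
  then obtain D where "(f has_derivative D) (at (w + t *s x))" "\<And>c v. D (c *s v) = c * D v"
    using assms unfolding mv_holomorphic_on_def by blast
  from has_field_derivative_along_line[OF this]
  show "\<exists>f'. ((\<lambda>t. f (w + t *s x)) has_field_derivative f') (at t within A)"
    using has_field_derivative_at_within by blast
qed

text \<open>
  The partial derivatives are those of the Frechet derivative along the coordinate axes, and complex
  linearity assembles them. This is what makes \<open>vf_apply\<close> a derivation.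
\<close>

lemma vf_apply_eq_derivative:
  fixes f :: "complex ^ 'n \<Rightarrow> complex"
  assumes f: "(f has_derivative D) (at z)" and D: "\<And>c v. D (c *s v) = c * D v"
  shows "vf_apply X f z = D X"
proof -
  have "partial_z j f z = D (axis j 1)" for j
  proof -
    have "h *s axis j 1 = axis j h" for h :: complex
      by (simp add: vec_eq_iff axis_def)
    moreover have "(f has_derivative D) (at (z + 0 *s axis j 1))"
      using f by simp
    ultimately have "((\<lambda>h. f (z + axis j h)) has_field_derivative D (axis j 1)) (at 0)"
      using has_field_derivative_along_line[of f D z 0 "axis j 1"] D by (simp only:)
    then show ?thesis
      unfolding partial_z_def by (rule DERIV_imp_deriv)
  qed
  then have "vf_apply X f z = (\<Sum>j\<in>UNIV. D (X $ j *s axis j 1))"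
    by (simp add: vf_apply_def D)
  also have "\<dots> = D (\<Sum>j\<in>UNIV. X $ j *s axis j 1)"
    by (rule linear_sum[symmetric, OF has_derivative_linear[OF f]])
  also have "(\<Sum>j\<in>UNIV. X $ j *s axis j 1) = X"
    by (simp add: vec_eq_iff axis_def if_distrib cong: if_cong)
  finally show ?thesis .
qed

lemma vf_apply_mult:
  assumes "mv_holomorphic_on f S" and "mv_holomorphic_on g S" and "z \<in> S"
  shows "vf_apply X (\<lambda>x. f x * g x) z = f z * vf_apply X g z + vf_apply X f z * g z"
proof -
  obtain D E where D: "(f has_derivative D) (at z)" "\<And>c v. D (c *s v) = c * D v"
    and E: "(g has_derivative E) (at z)" "\<And>c v. E (c *s v) = c * E v"
    using assms unfolding mv_holomorphic_on_def by meson
  have "vf_apply X (\<lambda>x. f x * g x) z = f z * E X + D X * g z"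
    by (rule vf_apply_eq_derivative[OF has_derivative_mult[OF D(1) E(1)]])
      (simp add: D E algebra_simps)
  then show ?thesis
    by (simp add: vf_apply_eq_derivative[OF D] vf_apply_eq_derivative[OF E])
qed

text \<open>
  Cauchy's estimate on the disc that the complex line through \<open>z\<close> in direction \<open>X\<close> cuts out of the
  ball; as a disc in the parameter \<open>t\<close> of \<open>z + t *s X\<close> it has radius \<open>r / norm X\<close>.
\<close>

lemma norm_vf_apply_le:
  assumes hol: "mv_holomorphic_on f (cball z r)" and "r > 0"
    and bound: "\<And>x. x \<in> cball z r \<Longrightarrow> norm (f x) \<le> C"
  shows "norm (vf_apply X f z) \<le> C * norm X / r"
proof -
  obtain D where D: "(f has_derivative D) (at z)" "\<And>c v. D (c *s v) = c * D v"
    using hol \<open>r > 0\<close> unfolding mv_holomorphic_on_def by (meson centre_in_cball less_imp_le)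
  note vf = vf_apply_eq_derivative[OF D]
  show ?thesis
  proof (cases "X = 0")
    case True
    then show ?thesis
      using linear_0[OF has_derivative_linear[OF D(1)]] by (simp add: vf)
  next
    case False
    define s where "s = r / norm X"
    have "s > 0"
      using False \<open>r > 0\<close> by (simp add: s_def)
    have in_ball: "z + t *s X \<in> cball z r" if "t \<in> cball 0 s" for t
      using that False by (simp add: dist_norm norm_vector_smult s_def field_simps)
    have hol1: "(\<lambda>t. f (z + t *s X)) holomorphic_on cball 0 s"
      by (rule mv_holomorphic_on_line[OF hol in_ball])
    have "deriv (\<lambda>t. f (z + t *s X)) 0 = D X"
      using has_field_derivative_along_line[of f D z 0 X] D by (simp add: DERIV_imp_deriv)
    moreover have "norm ((deriv ^^ 1) (\<lambda>t. f (z + t *s X)) 0) \<le> fact 1 * C / s ^ 1"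
      using \<open>s > 0\<close>
      by (intro Cauchy_inequality holomorphic_on_subset[OF hol1] bound in_ball
          holomorphic_on_imp_continuous_on[OF hol1]) auto
    ultimately show ?thesis
      by (simp add: vf s_def)
  qed
qed

section \<open>Mean value inequalities\<close>

lemma borel_measurable_ennreal_indicator:
  fixes g :: "'a::topological_space \<Rightarrow> real"
  assumes "S \<in> sets borel" and "continuous_on S g"
  shows "(\<lambda>x. ennreal (g x) * indicator S x) \<in> borel_measurable borel"
proof -
  have "(\<lambda>x. ennreal (indicator S x *\<^sub>R g x)) \<in> borel_measurable borel"
    by (intro measurable_compose[OF _ measurable_ennreal] borel_measurable_continuous_on_indicator assms)
  also have "(\<lambda>x. ennreal (indicator S x *\<^sub>R g x)) = (\<lambda>x. ennreal (g x) * indicator S x)"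
    by (auto simp: indicator_def)
  finally show ?thesis .
qed

lemma continuous_on_norm_powr:
  assumes "continuous_on S f" and "p > 0"
  shows "continuous_on S (\<lambda>x. norm (f x) powr p)"
  using assms by (intro continuous_on_powr' continuous_intros) auto

text \<open>
  Cauchy's integral formula on the unit circle, as a mean value inequality in Tonelli's setting.
\<close>

lemma norm_center_le_circle_mean:
  assumes contg: "continuous_on (cball 0 1) g" and holg: "g holomorphic_on ball 0 1"
  shows "ennreal (norm (g 0))
      \<le> (\<integral>\<^sup>+\<theta>. ennreal (norm (g (exp (2 * pi * \<i> * \<theta>)))) * indicator {0..1} \<theta> \<partial>(lborel :: real measure))"
proof -
  have "((\<lambda>u. g u / (u - 0)) has_contour_integral 2 * of_real pi * \<i> * g 0) (circlepath 0 1)"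
    by (rule Cauchy_integral_circlepath[OF contg holg]) simp
  then have "((\<lambda>\<theta>::real. 2 * of_real pi * \<i> * g (exp (2 * pi * \<i> * \<theta>)))
      has_integral 2 * of_real pi * \<i> * g 0) {0..1}"
    unfolding has_contour_integral vector_derivative_circlepath
    by (simp add: circlepath field_simps)
  then have mean: "((\<lambda>\<theta>::real. g (exp (2 * pi * \<i> * \<theta>))) has_integral g 0) {0..1}"
    by (subst (asm) has_integral_mult_right_iff) auto
  have cont: "continuous_on {0..1} (\<lambda>\<theta>::real. g (exp (2 * pi * \<i> * \<theta>)))"
    by (rule continuous_on_compose2[OF contg]) (auto intro!: continuous_intros)
  then have int: "(\<lambda>\<theta>::real. norm (g (exp (2 * pi * \<i> * \<theta>)))) integrable_on {0..1}"
    by (intro integrable_continuous_real continuous_intros)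
  have "norm (g 0) \<le> integral {0..1} (\<lambda>\<theta>::real. norm (g (exp (2 * pi * \<i> * \<theta>))))"
    using integral_norm_bound_integral[OF has_integral_integrable[OF mean] int] integral_unique[OF mean] by simp
  then show ?thesis
    using nn_integral_has_integral_lebesgue'[OF _ integrable_integral[OF int]]
    by (simp add: ennreal_leI)
qed

text \<open>
  The mean value inequality for \<open>|f|\<close> over a ball. On the complex line through \<open>w\<close> in direction \<open>x\<close>,
  \<open>|f w|\<close> is at most the mean of \<open>|f|\<close> over the circle of points \<open>w + e \<theta> *s x\<close> with \<open>|e \<theta>| = 1\<close>.
  Integrate over all \<open>x\<close> in the ball and exchange the integrals: for fixed \<open>\<theta>\<close>, multiplication by \<open>e \<theta>\<close>
  is an isometry, so the integral over \<open>x\<close> does not depend on \<open>\<theta>\<close>.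
\<close>

lemma norm_mv_holomorphic_le_ball_mean:
  fixes f :: "complex ^ 'n \<Rightarrow> complex"
  assumes hol: "mv_holomorphic_on f (ball w r)"
  shows "ennreal (norm (f w)) * emeasure lborel (ball w r)
      \<le> (\<integral>\<^sup>+x. ennreal (norm (f x)) * indicator (ball w r) x \<partial>lborel)"
proof -
  define F where "F = (\<lambda>x. ennreal (norm (f x)) * indicator (ball w r) x)"
  define G where "G = (\<lambda>x. F (w + x))"
  have cont: "continuous_on (ball w r) f"
    using hol by (rule mv_holomorphic_on_imp_continuous_on)
  have F [measurable]: "F \<in> borel_measurable borel"
    unfolding F_def by (intro borel_measurable_ennreal_indicator continuous_intros cont) auto
  have [measurable]: "G \<in> borel_measurable borel"
    unfolding G_def by measurable
  define e where "e = (\<lambda>\<theta>::real. exp (2 * pi * \<i> * \<theta>))"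
  have norm_e: "norm (e \<theta>) = 1" for \<theta>
    by (simp add: e_def)
  have "continuous_on UNIV (\<lambda>p::real \<times> (complex ^ 'n). e (fst p) *s snd p)"
    unfolding vector_scalar_mult_def e_def by (intro continuous_intros continuous_on_vec_lambda)
  then have rot [measurable]: "(\<lambda>p::real \<times> (complex ^ 'n). e (fst p) *s snd p) \<in> borel_measurable borel"
    by (rule borel_measurable_continuous_onI)
  have [measurable]: "(\<lambda>(\<theta>, x). e \<theta> *s x) \<in> borel_measurable (lborel \<Otimes>\<^sub>M (lborel :: (complex ^ 'n) measure))"
    using rot by (simp add: case_prod_beta' lborel_prod)
  have [measurable]: "(\<lambda>x. e \<theta> *s x) \<in> borel_measurable borel" for \<theta>
    by (intro borel_measurable_continuous_onI linear_continuous_on linear_conv_bounded_linear[THEN iffD1] linear_smult)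
  have "ennreal (norm (f w)) * emeasure lborel (ball w r)
      = (\<integral>\<^sup>+x. ennreal (norm (f w)) * indicator (ball 0 r) x \<partial>(lborel :: (complex ^ 'n) measure))"
  proof (cases "r \<ge> 0")
    case True
    then show ?thesis
      by (simp add: nn_integral_cmult_indicator emeasure_ball)
  next
    case False
    then have "ball w r = {}" "ball 0 r = ({} :: (complex ^ 'n) set)"
      by auto
    then show ?thesis by (simp only: emeasure_empty) simp
  qed
  also have "\<dots> \<le> (\<integral>\<^sup>+x. (\<integral>\<^sup>+\<theta>. G (e \<theta> *s x) * indicator {0..1} \<theta> \<partial>lborel) \<partial>lborel)"
  proof (rule nn_integral_mono)
    fix x :: "complex ^ 'n"
    show "ennreal (norm (f w)) * indicator (ball 0 r) x
        \<le> (\<integral>\<^sup>+\<theta>. G (e \<theta> *s x) * indicator {0..1} \<theta> \<partial>lborel)"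
    proof (cases "x \<in> ball 0 r")
      case True
      have in_ball: "w + t *s x \<in> ball w r" if "t \<in> cball 0 1" for t
      proof -
        have "norm t * norm x \<le> 1 * norm x"
          using that by (intro mult_right_mono) auto
        then show ?thesis
          using True by (simp add: dist_norm norm_vector_smult)
      qed
      have hol1: "(\<lambda>t. f (w + t *s x)) holomorphic_on cball 0 1"
        by (rule mv_holomorphic_on_line[OF hol in_ball])
      have "G (e \<theta> *s x) = ennreal (norm (f (w + e \<theta> *s x)))" for \<theta>
        using in_ball[of "e \<theta>"] norm_e[of \<theta>] by (simp add: G_def F_def)
      moreover have "ennreal (norm (f (w + 0 *s x)))
          \<le> (\<integral>\<^sup>+\<theta>. ennreal (norm (f (w + exp (2 * pi * \<i> * \<theta>) *s x))) * indicator {0..1} \<theta> \<partial>(lborel :: real measure))"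
        by (rule norm_center_le_circle_mean[where g = "\<lambda>t. f (w + t *s x)"])
          (auto intro: holomorphic_on_imp_continuous_on[OF hol1] holomorphic_on_subset[OF hol1])
      ultimately show ?thesis
        using True by (simp add: e_def)
    qed simp
  qed
  also have "\<dots> = (\<integral>\<^sup>+\<theta>. (\<integral>\<^sup>+x. G (e \<theta> *s x) * indicator {0..1} \<theta> \<partial>lborel) \<partial>lborel)"
    by (rule lborel_pair.Fubini') measurable
  also have "\<dots> = (\<integral>\<^sup>+\<theta>. (\<integral>\<^sup>+x. G x \<partial>lborel) * indicator {0..1} \<theta> \<partial>(lborel :: real measure))"
    by (simp add: nn_integral_multc
        nn_integral_lborel_orthogonal[OF orthogonal_transformation_unimodular[OF norm_e]])
  also have "\<dots> = (\<integral>\<^sup>+x. G x \<partial>lborel)"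
    by (simp add: nn_integral_cmult)
  also have "\<dots> = (\<integral>\<^sup>+x. F x \<partial>lborel)"
    unfolding G_def by (rule nn_integral_lborel_translate) fact
  finally show ?thesis
    unfolding F_def .
qed

text \<open>
  For exponents below 1 the mean value inequality for \<open>|f| powr q\<close> does not follow from convexity.
  Instead the inequality for \<open>|f|\<close> is bootstrapped, following Hardy and Littlewood: at a point where
  \<open>|f|\<close>, weighted by a power of the distance to the boundary, is maximal, \<open>|f|\<close> is controlled on a
  smaller ball by its value at the centre. The constant depends on \<open>q\<close>, \<open>A\<close> and \<open>R\<close> but not on \<open>f\<close>,
  which is why it is obtained before \<open>f\<close> is fixed.
\<close>

lemma mv_holomorphic_locally_bounded_of_small_powr_integral:
  fixes z :: "complex ^ 'n" and q A R :: real
  assumes "0 < q" "q \<le> 1" "0 \<le> A" "0 < R"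
  obtains C where "\<And>f x. \<lbrakk>mv_holomorphic_on f (cball z R);
      (\<integral>\<^sup>+x. ennreal (norm (f x) powr q) * indicator (ball z R) x \<partial>lborel) \<le> ennreal A;
      x \<in> cball z (R / 2)\<rbrakk> \<Longrightarrow> norm (f x) \<le> C"
proof -
  define n where "n = DIM(complex ^ 'n)"
  define e where "e = real n / q"
  define \<omega> where "\<omega> = unit_ball_vol (real n)"
  define K where "K = (A * 2 powr e / \<omega>) powr (1 / q)"
  have "n > 0"
    unfolding n_def by (rule DIM_positive)
  then have "e > 0"
    using \<open>0 < q\<close> by (simp add: e_def)
  have "\<omega> > 0"
    by (simp add: \<omega>_def)
  have "norm (f x) \<le> K * (R / 2) powr (- e)"
    if hol: "mv_holomorphic_on f (cball z R)"
      and int: "(\<integral>\<^sup>+x. ennreal (norm (f x) powr q) * indicator (ball z R) x \<partial>lborel) \<le> ennreal A"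
      and x: "x \<in> cball z (R / 2)" for f x
  proof -
    \<comment> \<open>The weight makes \<open>\<phi>\<close> vanish on the boundary, and \<open>e = n / q\<close> is the exponent for which the
      powers of the radius \<open>r\<close> below cancel.\<close>
    define \<phi> where "\<phi> = (\<lambda>x. norm (f x) * (R - dist z x) powr e)"
    have cont: "continuous_on (cball z R) f"
      using hol by (rule mv_holomorphic_on_imp_continuous_on)
    then have "continuous_on (cball z R) \<phi>"
      unfolding \<phi>_def using \<open>e > 0\<close> by (intro continuous_intros continuous_on_powr') auto
    then obtain w where w: "w \<in> cball z R" and max: "\<And>y. y \<in> cball z R \<Longrightarrow> \<phi> y \<le> \<phi> w"
      using continuous_attains_sup[of "cball z R" \<phi>] \<open>0 < R\<close> by auto
    define M where "M = \<phi> w"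
    have "M \<le> K"
    proof (cases "M = 0")
      case True
      then show ?thesis by (simp add: K_def)
    next
      case False
      \<comment> \<open>Half the distance from the maximum point to the boundary: on \<open>ball w r\<close> the weight has lost
        at most the factor \<open>2 powr e\<close>.\<close>
      define r where "r = (R - dist z w) / 2"
      have "dist z w \<noteq> R"
        using False \<open>e > 0\<close> by (auto simp: M_def \<phi>_def)
      then have "r > 0"
        using w by (simp add: r_def)
      have "M > 0"
        using False by (auto simp: M_def \<phi>_def)
      define N where "N = M * r powr (- e)"
      have "N > 0"
        using \<open>M > 0\<close> \<open>r > 0\<close> by (simp add: N_def)
      have near: "y \<in> ball z R \<and> norm (f y) \<le> N" if "y \<in> ball w r" for y
      proof -
        have "dist z y \<le> dist z w + dist w y"
          by (rule dist_triangle)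
        then have y: "dist z y < R - r"
          using that by (simp add: r_def field_simps)
        have "norm (f y) * r powr e \<le> \<phi> y"
          unfolding \<phi>_def using y \<open>r > 0\<close> \<open>e > 0\<close> by (intro mult_left_mono powr_mono2) auto
        also have "\<dots> \<le> M"
          unfolding M_def using y \<open>r > 0\<close> by (intro max) simp
        finally have "norm (f y) \<le> N"
          using \<open>r > 0\<close> by (simp add: N_def powr_minus field_simps)
        then show ?thesis
          using y \<open>r > 0\<close> by simp
      qed
      have sub: "ball w r \<subseteq> cball z R"
        using near by (meson ball_subset_cball subset_iff)
      \<comment> \<open>In the mean value inequality, split \<open>|f|\<close> as \<open>|f| powr (1 - q) * |f| powr q\<close> and estimate the
        first factor by the maximum: only \<open>N powr (1 - q)\<close> appears on the right, so the resulting
        inequality can be solved for \<open>N\<close>.\<close>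
      have "ennreal (norm (f w)) * ennreal (\<omega> * r ^ n)
          \<le> (\<integral>\<^sup>+x. ennreal (norm (f x)) * indicator (ball w r) x \<partial>lborel)"
        using norm_mv_holomorphic_le_ball_mean[OF mv_holomorphic_on_subset[OF hol sub]] \<open>r > 0\<close>
        by (simp add: emeasure_ball \<omega>_def n_def)
      also have "\<dots> \<le> (\<integral>\<^sup>+x. ennreal (N powr (1 - q)) *
          (ennreal (norm (f x) powr q) * indicator (ball z R) x) \<partial>lborel)"
      proof (rule nn_integral_mono)
        fix y
        show "ennreal (norm (f y)) * indicator (ball w r) y
            \<le> ennreal (N powr (1 - q)) * (ennreal (norm (f y) powr q) * indicator (ball z R) y)"
        proof (cases "y \<in> ball w r")
          case True
          have "norm (f y) = norm (f y) powr (1 - q) * norm (f y) powr q"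
            by (simp flip: powr_add)
          also have "\<dots> \<le> N powr (1 - q) * norm (f y) powr q"
            using near[OF True] \<open>q \<le> 1\<close> by (intro mult_right_mono powr_mono2) auto
          finally show ?thesis
            using near[OF True] True by (simp add: ennreal_leI flip: ennreal_mult)
        qed simp
      qed
      also have "\<dots> = ennreal (N powr (1 - q)) *
          (\<integral>\<^sup>+x. ennreal (norm (f x) powr q) * indicator (ball z R) x \<partial>lborel)"
        using \<open>0 < q\<close>
        by (intro nn_integral_cmult, simp, intro borel_measurable_ennreal_indicator continuous_on_norm_powr
            continuous_on_subset[OF cont ball_subset_cball]) auto
      also have "\<dots> \<le> ennreal (N powr (1 - q)) * ennreal A"
        by (intro mult_left_mono int) auto
      finally have "norm (f w) * (\<omega> * r ^ n) \<le> N powr (1 - q) * A"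
        using \<open>\<omega> > 0\<close> \<open>r > 0\<close> \<open>0 \<le> A\<close> by (simp flip: ennreal_mult)
      moreover have "norm (f w) = N * 2 powr (- e)"
      proof -
        have two_r: "2 * r = R - dist z w"
          by (simp add: r_def)
        have "M = norm (f w) * (2 * r) powr e"
          unfolding M_def \<phi>_def by (simp add: two_r)
        then show ?thesis
          using \<open>r > 0\<close> by (simp add: N_def powr_mult powr_minus field_simps)
      qed
      ultimately have "N * \<omega> * r ^ n \<le> N powr (1 - q) * A * 2 powr e"
        by (simp add: powr_minus field_simps)
      moreover have "N = N powr (1 - q) * N powr q"
        using \<open>N > 0\<close> by (simp flip: powr_add)
      ultimately have "N powr (1 - q) * (N powr q * \<omega> * r ^ n) \<le> N powr (1 - q) * (A * 2 powr e)"
        by (metis mult.assoc)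
      then have "N powr q * \<omega> * r ^ n \<le> A * 2 powr e"
        using \<open>N > 0\<close> by (subst (asm) mult_le_cancel_left_pos) auto
      moreover have "(r powr (- e)) powr q = r powr (- real n)"
        using \<open>0 < q\<close> by (simp add: powr_powr e_def)
      then have "N powr q * r ^ n = M powr q"
        using \<open>M > 0\<close> \<open>r > 0\<close> by (simp add: N_def powr_mult powr_minus powr_realpow)
      ultimately have "M powr q \<le> A * 2 powr e / \<omega>"
        using \<open>\<omega> > 0\<close> by (simp add: field_simps)
      then have "(M powr q) powr (1 / q) \<le> K"
        unfolding K_def using \<open>0 < q\<close> by (intro powr_mono2) auto
      then show ?thesis
        using \<open>M > 0\<close> \<open>0 < q\<close> by (simp add: powr_powr)
    qed
    have "norm (f x) * (R / 2) powr e \<le> \<phi> x"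
      unfolding \<phi>_def using x \<open>e > 0\<close> \<open>0 < R\<close> by (intro mult_left_mono powr_mono2) auto
    also have "\<dots> \<le> M"
      unfolding M_def using x \<open>0 < R\<close> by (intro max) auto
    also note \<open>M \<le> K\<close>
    finally show ?thesis
      using \<open>0 < R\<close> by (simp add: powr_minus field_simps)
  qed
  then show thesis
    by (rule that)
qed

section \<open>Bergman spaces\<close>

lemma Lp_norm_nonneg [simp]: "0 \<le> Lp_norm p \<Omega> f"
  by (simp add: Lp_norm_def)

lemma bergman_space_hol: "f \<in> bergman_space p \<Omega> \<Longrightarrow> mv_holomorphic_on f \<Omega>"
  by (simp add: bergman_space_def)

text \<open>
  Comparisons of \<open>Lp\<close> norms are made through nonnegative integrals over \<open>lborel\<close>, where monotonicity
  and Tonelli carry no integrability side conditions.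
\<close>

lemma nn_integral_eq_Lp_norm:
  assumes "f \<in> bergman_space p \<Omega>" and "p > 0"
  shows "(\<integral>\<^sup>+x. ennreal (norm (f x) powr p) * indicator \<Omega> x \<partial>lborel) = ennreal (Lp_norm p \<Omega> f powr p)"
proof -
  have int: "integrable lebesgue (\<lambda>x. indicator \<Omega> x *\<^sub>R norm (f x) powr p)"
    using assms(1) by (simp add: bergman_space_def set_integrable_def)
  have nonneg: "0 \<le> (LINT x:\<Omega>|lebesgue. norm (f x) powr p)"
    unfolding set_lebesgue_integral_def by (intro integral_nonneg_AE) auto
  have "(\<integral>\<^sup>+x. ennreal (norm (f x) powr p) * indicator \<Omega> x \<partial>lborel)
      = (\<integral>\<^sup>+x. ennreal (indicator \<Omega> x *\<^sub>R norm (f x) powr p) \<partial>lebesgue)"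
    by (subst nn_integral_completion) (auto intro!: nn_integral_cong simp: indicator_def)
  also have "\<dots> = ennreal (LINT x:\<Omega>|lebesgue. norm (f x) powr p)"
    unfolding set_lebesgue_integral_def by (intro nn_integral_eq_integral int) auto
  also have "(LINT x:\<Omega>|lebesgue. norm (f x) powr p) = Lp_norm p \<Omega> f powr p"
    using nonneg \<open>p > 0\<close> by (simp add: Lp_norm_def powr_powr)
  finally show ?thesis .
qed

lemma bergman_spaceI:
  assumes "open \<Omega>" and "p > 0" and hol: "mv_holomorphic_on f \<Omega>"
    and fin: "(\<integral>\<^sup>+x. ennreal (norm (f x) powr p) * indicator \<Omega> x \<partial>lborel) < \<infinity>"
  shows "f \<in> bergman_space p \<Omega>"
proof -
  have "continuous_on \<Omega> (\<lambda>x. norm (f x) powr p)"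
    using mv_holomorphic_on_imp_continuous_on[OF hol] \<open>p > 0\<close> by (rule continuous_on_norm_powr)
  then have "(\<lambda>x. indicator \<Omega> x *\<^sub>R norm (f x) powr p) \<in> borel_measurable lborel"
    using \<open>open \<Omega>\<close> by (simp add: borel_measurable_continuous_on_indicator del: real_scaleR_def)
  moreover have "(\<integral>\<^sup>+x. ennreal (indicator \<Omega> x *\<^sub>R norm (f x) powr p) \<partial>lborel) < \<infinity>"
    using fin by (subst nn_integral_cong[where v = "\<lambda>x. ennreal (norm (f x) powr p) * indicator \<Omega> x"])
      (auto simp: indicator_def)
  ultimately have "integrable lborel (\<lambda>x. indicator \<Omega> x *\<^sub>R norm (f x) powr p)"
    by (intro integrableI_nonneg) auto
  then show ?thesis
    using hol by (simp add: bergman_space_def set_integrable_def integrable_completion borel_measurable_integrable)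
qed

text \<open>
  Multiplication by a holomorphic function of modulus at most 1 is a contraction of the Bergman space.
  This is the point at which the sup norm in the Caratheodory metric enters.
\<close>

lemma bergman_space_mult_bounded:
  assumes "open \<Omega>" and "p > 0"
    and f: "mv_holomorphic_on f \<Omega>" "\<And>x. x \<in> \<Omega> \<Longrightarrow> norm (f x) \<le> 1"
    and g: "g \<in> bergman_space p \<Omega>"
  shows "(\<lambda>x. f x * g x) \<in> bergman_space p \<Omega>" (is "?h \<in> _")
    and "Lp_norm p \<Omega> (\<lambda>x. f x * g x) \<le> Lp_norm p \<Omega> g"
proof -
  have le: "(\<integral>\<^sup>+x. ennreal (norm (?h x) powr p) * indicator \<Omega> x \<partial>lborel) \<le> ennreal (Lp_norm p \<Omega> g powr p)"
    unfolding nn_integral_eq_Lp_norm[OF g \<open>p > 0\<close>, symmetric]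
  proof (rule nn_integral_mono)
    fix x
    show "ennreal (norm (?h x) powr p) * indicator \<Omega> x \<le> ennreal (norm (g x) powr p) * indicator \<Omega> x"
    proof (cases "x \<in> \<Omega>")
      case True
      then have "norm (?h x) \<le> norm (g x)"
        using f(2)[OF True] by (simp add: norm_mult mult_left_le_one_le)
      then show ?thesis
        using \<open>p > 0\<close> by (intro mult_right_mono ennreal_leI powr_mono2) auto
    qed simp
  qed
  show h: "?h \<in> bergman_space p \<Omega>"
    using le by (intro bergman_spaceI assms mv_holomorphic_on_mult bergman_space_hol[OF g])
      (auto simp: less_top[symmetric] top_unique)
  have "Lp_norm p \<Omega> ?h powr p \<le> Lp_norm p \<Omega> g powr p"
    using le unfolding nn_integral_eq_Lp_norm[OF h \<open>p > 0\<close>] by simp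
  then show "Lp_norm p \<Omega> ?h \<le> Lp_norm p \<Omega> g"
    using \<open>p > 0\<close> powr_less_mono2[of p "Lp_norm p \<Omega> g" "Lp_norm p \<Omega> ?h"] by fastforce
qed

lemma const_in_bergman_space:
  assumes "open \<Omega>" and "bounded \<Omega>" and "p > 0"
  shows "(\<lambda>_. c) \<in> bergman_space p \<Omega>"
proof (rule bergman_spaceI)
  show "(\<integral>\<^sup>+x. ennreal (norm c powr p) * indicator \<Omega> x \<partial>lborel) < \<infinity>"
    using assms emeasure_bounded_finite[OF \<open>bounded \<Omega>\<close>]
    by (simp add: nn_integral_cmult_indicator ennreal_mult_less_top)
qed (use assms mv_holomorphic_on_const in auto)

lemma bergman_space_cmult:
  assumes f: "f \<in> bergman_space p \<Omega>" and "p > 0"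
  shows "(\<lambda>x. c * f x) \<in> bergman_space p \<Omega>"
    and "Lp_norm p \<Omega> (\<lambda>x. c * f x) = norm c * Lp_norm p \<Omega> f"
proof -
  show "(\<lambda>x. c * f x) \<in> bergman_space p \<Omega>"
    using f by (simp add: bergman_space_def norm_mult powr_mult mv_holomorphic_on_mult mv_holomorphic_on_const)
  show "Lp_norm p \<Omega> (\<lambda>x. c * f x) = norm c * Lp_norm p \<Omega> f"
    using \<open>p > 0\<close> by (simp add: Lp_norm_def norm_mult powr_mult powr_powr set_lebesgue_integral_def)
qed

lemma Lp_norm_pos:
  assumes "open \<Omega>" and "p > 0" and f: "f \<in> bergman_space p \<Omega>" and x: "x \<in> \<Omega>" "f x \<noteq> 0"
  shows "0 < Lp_norm p \<Omega> f"
proof -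
  \<comment> \<open>By continuity, \<open>|f|\<close> exceeds half of \<open>|f x|\<close> on a small ball.\<close>
  have "open (\<Omega> \<inter> f -` {y. norm (f x) / 2 < norm y})"
    using mv_holomorphic_on_imp_continuous_on[OF bergman_space_hol[OF f]] \<open>open \<Omega>\<close>
    by (rule continuous_open_preimage) (intro open_Collect_less continuous_intros)
  moreover have "x \<in> \<Omega> \<inter> f -` {y. norm (f x) / 2 < norm y}"
    using x by simp
  ultimately obtain r where "r > 0" and r: "ball x r \<subseteq> \<Omega> \<inter> f -` {y. norm (f x) / 2 < norm y}"
    by (meson openE)
  have "0 < ennreal ((norm (f x) / 2) powr p) * emeasure lborel (ball x r)"
    using x \<open>r > 0\<close> by (simp add: emeasure_ball ennreal_zero_less_mult_iff)
  also have "\<dots> = (\<integral>\<^sup>+y. ennreal ((norm (f x) / 2) powr p) * indicator (ball x r) y \<partial>lborel)"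
    by (simp add: nn_integral_cmult_indicator)
  also have "\<dots> \<le> (\<integral>\<^sup>+y. ennreal (norm (f y) powr p) * indicator \<Omega> y \<partial>lborel)"
  proof (rule nn_integral_mono)
    fix y
    show "ennreal ((norm (f x) / 2) powr p) * indicator (ball x r) y
        \<le> ennreal (norm (f y) powr p) * indicator \<Omega> y"
    proof (cases "y \<in> ball x r")
      case True
      then have "y \<in> \<Omega>" "norm (f x) / 2 < norm (f y)"
        using r by auto
      then show ?thesis
        using True \<open>p > 0\<close> by (auto intro!: ennreal_leI powr_mono2)
    qed simp
  qed
  also have "\<dots> = ennreal (Lp_norm p \<Omega> f powr p)"
    by (rule nn_integral_eq_Lp_norm[OF f \<open>p > 0\<close>])
  finally have "Lp_norm p \<Omega> f \<noteq> 0"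
    by auto
  then show ?thesis
    using Lp_norm_nonneg[of p \<Omega> f] by linarith
qed

section \<open>The extremal problem for derivatives\<close>

text \<open>
  The values whose supremum occurs in the definition of the Bergman metric.
\<close>

definition unit_derivatives :: "real \<Rightarrow> (complex ^ 'n) set \<Rightarrow> complex ^ 'n \<Rightarrow> complex ^ 'n \<Rightarrow> real set"
  where "unit_derivatives p \<Omega> z X =
    {norm (vf_apply X f z) |f. f \<in> bergman_space p \<Omega> \<and> f z = 0 \<and> Lp_norm p \<Omega> f = 1}"

text \<open>
  A real \<open>Sup\<close> dominates the members of its set only if the set is bounded above. Here the bound comes
  from Cauchy's estimate on a ball on which all members of the unit sphere of the Bergman space are
  uniformly bounded.
\<close>

lemma bdd_above_unit_derivatives:
  assumes "open \<Omega>" and "p > 0" and "z \<in> \<Omega>"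
  shows "bdd_above (unit_derivatives p \<Omega> z X)"
proof -
  obtain R where "R > 0" and R: "cball z R \<subseteq> \<Omega>"
    using \<open>open \<Omega>\<close> \<open>z \<in> \<Omega>\<close> by (meson open_contains_cball)
  \<comment> \<open>The local bound needs an exponent of at most 1; since \<open>t powr q \<le> 1 + t powr p\<close> for
    \<open>q = min p 1\<close>, lowering the exponent costs only the volume of the ball.\<close>
  define q where "q = min p 1"
  define A where "A = measure lborel (ball z R) + 1"
  have "0 < q" "q \<le> 1" "0 \<le> A"
    using \<open>p > 0\<close> by (auto simp: q_def A_def)
  obtain C where C: "\<And>f x. \<lbrakk>mv_holomorphic_on f (cball z R);
      (\<integral>\<^sup>+x. ennreal (norm (f x) powr q) * indicator (ball z R) x \<partial>lborel) \<le> ennreal A;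
      x \<in> cball z (R / 2)\<rbrakk> \<Longrightarrow> norm (f x) \<le> C"
    using mv_holomorphic_locally_bounded_of_small_powr_integral
      [OF \<open>0 < q\<close> \<open>q \<le> 1\<close> \<open>0 \<le> A\<close> \<open>R > 0\<close>] by blast
  have "norm (vf_apply X f z) \<le> C * norm X / (R / 2)"
    if f: "f \<in> bergman_space p \<Omega>" and norm1: "Lp_norm p \<Omega> f = 1" for f
  proof -
    have hol: "mv_holomorphic_on f (cball z R)"
      by (rule mv_holomorphic_on_subset[OF bergman_space_hol[OF f] R])
    have "(\<integral>\<^sup>+x. ennreal (norm (f x) powr q) * indicator (ball z R) x \<partial>lborel)
        \<le> (\<integral>\<^sup>+x. indicator (ball z R) x + ennreal (norm (f x) powr p) * indicator \<Omega> x \<partial>lborel)"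
    proof (rule nn_integral_mono)
      fix x
      have "norm (f x) powr q \<le> 1 + norm (f x) powr p"
      proof (cases "norm (f x) \<le> 1")
        case True
        then have "norm (f x) powr q \<le> 1"
          using \<open>0 < q\<close> by (intro powr_le1) auto
        then show ?thesis
          by (simp add: add_increasing2)
      next
        case False
        then have "norm (f x) powr q \<le> norm (f x) powr p"
          by (intro powr_mono) (auto simp: q_def)
        then show ?thesis by simp
      qed
      then have "ennreal (norm (f x) powr q) \<le> 1 + ennreal (norm (f x) powr p)"
        by (metis ennreal_1 ennreal_leI ennreal_plus powr_ge_zero zero_le_one)
      moreover have "x \<in> ball z R \<Longrightarrow> x \<in> \<Omega>"
        using R by auto
      ultimately show "ennreal (norm (f x) powr q) * indicator (ball z R) x
          \<le> indicator (ball z R) x + ennreal (norm (f x) powr p) * indicator \<Omega> x"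
        by (auto simp: indicator_def)
    qed
    also have "\<dots> = emeasure lborel (ball z R)
        + (\<integral>\<^sup>+x. ennreal (norm (f x) powr p) * indicator \<Omega> x \<partial>lborel)"
      using \<open>open \<Omega>\<close> \<open>p > 0\<close> mv_holomorphic_on_imp_continuous_on[OF bergman_space_hol[OF f]]
      by (subst nn_integral_add)
        (auto intro!: borel_measurable_ennreal_indicator continuous_on_norm_powr borel_measurable_indicator)
    also have "\<dots> = ennreal A"
      using emeasure_bounded_finite[of "ball z R"]
      by (simp add: nn_integral_eq_Lp_norm[OF f \<open>p > 0\<close>] norm1 A_def emeasure_eq_ennreal_measure)
    finally have "(\<integral>\<^sup>+x. ennreal (norm (f x) powr q) * indicator (ball z R) x \<partial>lborel) \<le> ennreal A" .
    then show ?thesis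
      using \<open>R > 0\<close> by (intro norm_vf_apply_le C mv_holomorphic_on_subset[OF hol]) auto
  qed
  then show ?thesis
    unfolding unit_derivatives_def by (intro bdd_aboveI[where M = "C * norm X / (R / 2)"]) blast
qed

text \<open>
  The homogeneous form of the extremal problem. A function of norm 0 cannot be normalised, but it
  vanishes on \<open>\<Omega>\<close>, so its derivative at \<open>z\<close> vanishes too; this spares the users of the lemma a proof
  that their function is nonzero.
\<close>

lemma norm_vf_apply_le_Lp_norm:
  assumes "open \<Omega>" and "p > 0" and "z \<in> \<Omega>" and h: "h \<in> bergman_space p \<Omega>" "h z = 0"
  shows "norm (vf_apply X h z) \<le> Lp_norm p \<Omega> h * Sup (unit_derivatives p \<Omega> z X)"
proof (cases "Lp_norm p \<Omega> h = 0")
  case True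
  then have zero: "h x = 0" if "x \<in> \<Omega>" for x
    using Lp_norm_pos[OF \<open>open \<Omega>\<close> \<open>p > 0\<close> h(1) that] by auto
  obtain r where r: "r > 0" "cball z r \<subseteq> \<Omega>"
    using \<open>open \<Omega>\<close> \<open>z \<in> \<Omega>\<close> by (meson open_contains_cball)
  then have "norm (vf_apply X h z) \<le> 0 * norm X / r"
    using zero by (intro norm_vf_apply_le mv_holomorphic_on_subset[OF bergman_space_hol[OF h(1)]]) auto
  then show ?thesis
    using True by simp
next
  case False
  define L where "L = Lp_norm p \<Omega> h"
  have "L > 0"
    using False Lp_norm_nonneg[of p \<Omega> h] unfolding L_def by linarith
  define u where "u = (\<lambda>x. complex_of_real (1 / L) * h x)"
  have "u \<in> bergman_space p \<Omega>" "Lp_norm p \<Omega> u = 1" "u z = 0"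
    using bergman_space_cmult[OF h(1) \<open>p > 0\<close>, of "complex_of_real (1 / L)"] \<open>L > 0\<close> h(2)
    by (auto simp: u_def norm_divide simp flip: L_def)
  then have "norm (vf_apply X u z) \<le> Sup (unit_derivatives p \<Omega> z X)"
    by (intro cSup_upper bdd_above_unit_derivatives assms) (auto simp: unit_derivatives_def)
  moreover have "vf_apply X u z = complex_of_real (1 / L) * vf_apply X h z"
    using vf_apply_mult[OF mv_holomorphic_on_const bergman_space_hol[OF h(1)] \<open>z \<in> \<Omega>\<close>, of X "complex_of_real (1 / L)"] h(2)
    by (simp add: u_def)
  ultimately show ?thesis
    using \<open>L > 0\<close> by (simp add: norm_mult norm_divide field_simps flip: L_def)
qed

text \<open>
  \<open>K\<^sub>p powr (- 1 / p)\<close> is \<open>m\<^sub>p\<close> again. This includes the case \<open>m\<^sub>p = 0\<close>, since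
  \<open>0 powr a = 0\<close>.
\<close>

lemma bergman_metric_eq:
  assumes "open \<Omega>" and "bounded \<Omega>" and "p > 0"
  shows "bergman_metric p \<Omega> z X = bergman_min p \<Omega> z * Sup (unit_derivatives p \<Omega> z X)"
proof -
  have "0 \<le> bergman_min p \<Omega> z"
    unfolding bergman_min_def using const_in_bergman_space[OF assms, of 1]
    by (intro cInf_greatest) auto
  then have "bergman_kernel p \<Omega> z powr (- 1 / p) = bergman_min p \<Omega> z"
    using \<open>p > 0\<close> by (simp add: bergman_kernel_def powr_powr)
  then show ?thesis
    by (simp add: bergman_metric_def unit_derivatives_def)
qed

section \<open>Comparison with the Caratheodory metric\<close>

lemma norm_le_sup_norm:
  assumes "bounded (f ` \<Omega>)" and "x \<in> \<Omega>"
  shows "norm (f x) \<le> sup_norm \<Omega> f"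
proof -
  have "bdd_above ((\<lambda>x. norm (f x)) ` \<Omega>)"
    using assms(1) by (auto simp: bounded_iff bdd_above_def)
  then show ?thesis
    unfolding sup_norm_def using \<open>x \<in> \<Omega>\<close> by (rule cSUP_upper[rotated])
qed

text \<open>
  A normalised affine function. It shows that the supremum in the Caratheodory metric is taken over a
  nonempty set, without which a real \<open>Sup\<close> would have an unspecified value.
\<close>

lemma normalised_bounded_holomorphic_exists:
  fixes \<Omega> :: "(complex ^ 'n) set"
  assumes "open \<Omega>" and "bounded \<Omega>" and "z \<in> \<Omega>"
  obtains f where "f \<in> bounded_holomorphic \<Omega>" "f z = 0" "sup_norm \<Omega> f = 1"
proof -
  obtain j :: 'n where True by simp
  define g where "g = (\<lambda>x::complex ^ 'n. x $ j - z $ j)"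
  have hol: "mv_holomorphic_on g \<Omega>"
    unfolding g_def by (rule mv_holomorphic_on_component)
  have "bounded ((\<lambda>x. x - z) ` \<Omega>)"
    using \<open>bounded \<Omega>\<close> by (rule bounded_translation_minus)
  then obtain B where B: "\<And>x. x \<in> \<Omega> \<Longrightarrow> norm (x - z) \<le> B"
    unfolding bounded_iff by auto
  have "norm (g x) \<le> B" if "x \<in> \<Omega>" for x
    using B[OF that] Finite_Cartesian_Product.norm_nth_le[of "x - z" j] by (simp add: g_def)
  then have bg: "bounded (g ` \<Omega>)"
    by (auto simp: bounded_iff)
  define s where "s = sup_norm \<Omega> g"
  have "s > 0"
  proof -
    obtain r where "r > 0" and r: "cball z r \<subseteq> \<Omega>"
      using \<open>open \<Omega>\<close> \<open>z \<in> \<Omega>\<close> by (meson open_contains_cball)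
    define x where "x = z + complex_of_real r *s axis j 1"
    have "x \<in> cball z r"
      using \<open>r > 0\<close> by (simp add: x_def dist_norm norm_vector_smult norm_axis_1)
    then have "norm (g x) \<le> s"
      unfolding s_def using r by (intro norm_le_sup_norm bg) auto
    moreover have "norm (g x) = r"
      using \<open>r > 0\<close> by (simp add: g_def x_def)
    ultimately show ?thesis
      using \<open>r > 0\<close> by simp
  qed
  define f where "f = (\<lambda>x. complex_of_real (1 / s) * g x)"
  have norm_f: "norm (f x) = norm (g x) / s" for x
    using \<open>s > 0\<close> by (simp add: f_def norm_mult norm_divide)
  have f_le: "norm (f x) \<le> 1" if "x \<in> \<Omega>" for x
    using norm_le_sup_norm[OF bg that] \<open>s > 0\<close> by (simp add: norm_f flip: s_def)
  then have bf: "bounded (f ` \<Omega>)"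
    by (auto simp: bounded_iff)
  have "s \<le> s * sup_norm \<Omega> f"
    unfolding s_def sup_norm_def[of \<Omega> g]
  proof (rule cSUP_least)
    fix x assume "x \<in> \<Omega>"
    then show "norm (g x) \<le> (SUP x\<in>\<Omega>. norm (g x)) * sup_norm \<Omega> f"
      using norm_le_sup_norm[OF bf] \<open>s > 0\<close>
      by (simp add: norm_f field_simps flip: sup_norm_def s_def)
  qed (use \<open>z \<in> \<Omega>\<close> in auto)
  moreover have "sup_norm \<Omega> f \<le> 1"
    unfolding sup_norm_def using f_le \<open>z \<in> \<Omega>\<close> by (intro cSUP_least) auto
  ultimately have "sup_norm \<Omega> f = 1"
    using \<open>s > 0\<close> by simp
  moreover have "f \<in> bounded_holomorphic \<Omega>"
    using bf mv_holomorphic_on_mult[OF mv_holomorphic_on_const hol]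
    by (simp add: bounded_holomorphic_def f_def del: of_real_divide)
  moreover have "f z = 0"
    by (simp add: f_def g_def)
  ultimately show thesis
    using that by blast
qed

theorem proposition2p20:
  fixes \<Omega> :: "(complex ^ 'n) set" and p :: real and z X :: "complex ^ 'n"
  assumes "open \<Omega>" and "connected \<Omega>" and "bounded \<Omega>"
    and "p > 0"
    and "z \<in> \<Omega>"
  shows "bergman_metric p \<Omega> z X \<ge> caratheodory_metric \<Omega> z X"
proof -
  define S where "S = Sup (unit_derivatives p \<Omega> z X)"
  have one: "(\<lambda>_. 1) \<in> bergman_space p \<Omega>"
    by (rule const_in_bergman_space[OF \<open>open \<Omega>\<close> \<open>bounded \<Omega>\<close> \<open>p > 0\<close>])
  have le: "norm (vf_apply X f z) \<le> bergman_min p \<Omega> z * S"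
    if f: "f \<in> bounded_holomorphic \<Omega>" "f z = 0" "sup_norm \<Omega> f = 1" for f
  proof -
    have hol: "mv_holomorphic_on f \<Omega>" and f_le: "\<And>x. x \<in> \<Omega> \<Longrightarrow> norm (f x) \<le> 1"
      using f norm_le_sup_norm[of f \<Omega>] by (auto simp: bounded_holomorphic_def)
    have mult: "(\<lambda>x. f x * g x) \<in> bergman_space p \<Omega>"
        "Lp_norm p \<Omega> (\<lambda>x. f x * g x) \<le> Lp_norm p \<Omega> g" if "g \<in> bergman_space p \<Omega>" for g
      using bergman_space_mult_bounded[OF \<open>open \<Omega>\<close> \<open>p > 0\<close> hol _ that] f_le by auto
    have S_le: "norm (vf_apply X h z) \<le> Lp_norm p \<Omega> h * S"
      if "h \<in> bergman_space p \<Omega>" "h z = 0" for h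
      unfolding S_def using assms that by (intro norm_vf_apply_le_Lp_norm)
    \<comment> \<open>\<open>f\<close> itself, as the product of \<open>f\<close> and the constant 1, is a nonzero competitor.\<close>
    have "S \<ge> 0"
    proof -
      obtain x where "x \<in> \<Omega>" "f x \<noteq> 0"
      proof (rule ccontr)
        assume "\<not> thesis"
        then have "\<And>x. x \<in> \<Omega> \<Longrightarrow> f x = 0"
          using that by blast
        then have "sup_norm \<Omega> f = (SUP x\<in>\<Omega>. 0)"
          unfolding sup_norm_def by (intro SUP_cong) auto
        then show False
          using f(3) \<open>z \<in> \<Omega>\<close> cSUP_const[of \<Omega> "0::real"] by (metis empty_iff zero_neq_one)
      qed
      have f_in: "f \<in> bergman_space p \<Omega>"
        using mult(1)[OF one] by simp
      then have "0 < Lp_norm p \<Omega> f"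
        using \<open>open \<Omega>\<close> \<open>p > 0\<close> \<open>x \<in> \<Omega>\<close> \<open>f x \<noteq> 0\<close> by (intro Lp_norm_pos)
      moreover have "0 \<le> Lp_norm p \<Omega> f * S"
        using S_le[OF f_in f(2)] norm_ge_zero by (rule order_trans[rotated])
      ultimately show ?thesis
        by (simp add: zero_le_mult_iff)
    qed
    \<comment> \<open>\<open>f * g\<close> vanishes at \<open>z\<close>, and there it has the same derivative as \<open>f\<close> because \<open>g z = 1\<close>.\<close>
    have key: "norm (vf_apply X f z) \<le> Lp_norm p \<Omega> g * S"
      if g: "g \<in> bergman_space p \<Omega>" "g z = 1" for g
    proof -
      have "vf_apply X (\<lambda>x. f x * g x) z = vf_apply X f z"
        using vf_apply_mult[OF hol bergman_space_hol[OF g(1)] \<open>z \<in> \<Omega>\<close>, of X] f(2) g(2) by simp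
      then have "norm (vf_apply X f z) \<le> Lp_norm p \<Omega> (\<lambda>x. f x * g x) * S"
        using S_le[OF mult(1)[OF g(1)]] f(2) by simp
      also have "\<dots> \<le> Lp_norm p \<Omega> g * S"
        using mult(2)[OF g(1)] \<open>S \<ge> 0\<close> by (rule mult_right_mono)
      finally show ?thesis .
    qed
    show ?thesis
    proof (cases "S = 0")
      case True
      then show ?thesis
        using key[OF one] by simp
    next
      case False
      then have "S > 0"
        using \<open>S \<ge> 0\<close> by simp
      have "norm (vf_apply X f z) / S \<le> bergman_min p \<Omega> z"
        unfolding bergman_min_def
      proof (rule cInf_greatest)
        fix N assume "N \<in> {Lp_norm p \<Omega> g |g. g \<in> bergman_space p \<Omega> \<and> g z = 1}"
        then show "norm (vf_apply X f z) / S \<le> N"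
          using key \<open>S > 0\<close> by (auto simp: field_simps)
      qed (use one in blast)
      then show ?thesis
        using \<open>S > 0\<close> by (simp add: field_simps)
    qed
  qed
  have "caratheodory_metric \<Omega> z X \<le> bergman_min p \<Omega> z * S"
    unfolding caratheodory_metric_def
  proof (rule cSup_least)
    obtain f where "f \<in> bounded_holomorphic \<Omega>" "f z = 0" "sup_norm \<Omega> f = 1"
      using normalised_bounded_holomorphic_exists[OF \<open>open \<Omega>\<close> \<open>bounded \<Omega>\<close> \<open>z \<in> \<Omega>\<close>] .
    then show "{norm (vf_apply X f z) |f. f \<in> bounded_holomorphic \<Omega> \<and> f z = 0 \<and> sup_norm \<Omega> f = 1} \<noteq> {}"
      by blast
  qed (use le in blast)
  then show ?thesis
    by (simp add: S_def bergman_metric_eq[OF \<open>open \<Omega>\<close> \<open>bounded \<Omega>\<close> \<open>p > 0\<close>])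
qed

end
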